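(* Assume $g<\alpha<1$. The transformation $\Phi_\alpha$ maps $\Omega_\alpha$ one-to-one onto $\Omega_\alpha$ up to a null-set. More precisely, denoting $2K+1=d_\alpha(\varphi_\alpha(\alpha))$, we have $$\Phi_\alpha(\Omega_{1;\alpha})=\Omega_{III;\alpha},\qquad \Phi_\alpha(\Omega_{2;\alpha})=\Omega_{II;\alpha},$$ $$\Phi_\alpha(\Omega_{3;\alpha})=I_\alpha\times\bigcup_{k\ge1}\left[\tfrac1{2k+1},\tfrac1{2k-1+G}\right),\qquad \Phi_\alpha(\Omega_{4;\alpha})=I_\alpha\times\bigcup_{k\ge1}\left(\tfrac1{2k+3-G},\tfrac1{2k+1}\right],$$ $$\Phi_\alpha(\Omega_{5;\alpha})=I_\alpha\times\bigcup_{k\ge1}\left(\tfrac1{2k+1+G},\tfrac1{2k+2}\right],$$ $$\Phi_\alpha(\Omega_{6;\alpha})=\left(I_\alpha\times\bigcup_{1\le k\le K-1}\left(\tfrac1{2k+2},\tfrac1{2k+3-G}\right]\right)\cup\left([\alpha-2,\varphi_\alpha^2(\alpha))\times\left(\tfrac1{2K+2},\tfrac1{2K+3-G}\right]\right),$$ $$\Phi_\alpha(\Omega_{7;\alpha})=\left(I_\alpha\times\bigcup_{k\ge K+1}\left[\tfrac1{2k+2},\tfrac1{2k+3-G}\right)\right)\cup\left([\varphi_\alpha^2(\alpha),\alpha)\times\left[\tfrac1{2K+2},\tfrac1{2K+3-G}\right)\right).$$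
   Context: $g=\frac12(\sqrt5-1)$, $G=\frac12(\sqrt5+1)$, $[\cdot]$ in formulas for $d_\alpha$ is the integer part (floor). $I_\alpha=[\alpha-2,\alpha)$. For $x\ne0$, $d_\alpha(x)=2\left[\frac1{2|x|}+\frac{1-\alpha}2\right]+1$ and $\varphi_\alpha(x)=\frac1{|x|}-d_\alpha(x)$, with $\varphi_\alpha(0)=0$; the same formulas are used at $x=\alpha$ (which is not in $I_\alpha$) to define $d_\alpha(\alpha)$ and $\varphi_\alpha(\alpha)=\frac1\alpha-d_\alpha(\alpha)$, and $\varphi_\alpha^2(\alpha)=\varphi_\alpha(\varphi_\alpha(\alpha))$. With $e(x)=\operatorname{sign}(x)$, define for $x\neq 0$ $$\Phi_\alpha(x,y)=\left(\varphi_\alpha(x),\frac1{d_\alpha(x)+e(x)y}\right).$$ Put $\Omega_{I;\alpha}=I_\alpha\times[0,2-G)$, $\Omega_{II;\alpha}=(\varphi_\alpha(\alpha),\alpha)\times(2-G,1]$, $\Omega_{III;\alpha}=[\varphi_\alpha(\alpha-2),\alpha)\times[1,G)$, and $\Omega_\alpha=\Omega_{I;\alpha}\cup\Omega_{II;\alpha}\cup\Omega_{III;\alpha}$. Up to a null-set, $\Omega_\alpha$ is partitioned into $\Omega_{1;\alpha}=[\alpha-2,-\frac1{1+\alpha})\times[0,2-G)$, $\Omega_{2;\alpha}=(\frac1{1+\alpha},\alpha)\times[0,G)$, $\Omega_{3;\alpha}=[-\frac1{1+\alpha},0)\times[0,2-G)$, $\Omega_{4;\alpha}=(0,\frac1{1+\alpha}]\times[0,2-G)$,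 $\Omega_{5;\alpha}=(0,\frac1{1+\alpha}]\times[1,G)$, $\Omega_{6;\alpha}=(\varphi_\alpha(\alpha),\frac1{1+\alpha}]\times[2-G,1)$, $\Omega_{7;\alpha}=[\varphi_\alpha(\alpha-2),0)\times[1,G)$. A null-set is a set of Lebesgue measure zero. "One-to-one onto up to a null-set" means that after removing null-sets $N_1,N_2$ from $\Omega_\alpha$, $\Phi_\alpha$ is a bijection from $\Omega_\alpha\setminus N_1$ onto $\Omega_\alpha\setminus N_2$. *)

theory Defs
  imports "HOL-Analysis.Analysis"
begin

definition gold_g :: real where
  "gold_g = (sqrt 5 - 1) / 2"

definition gold_G :: real where
  "gold_G = (sqrt 5 + 1) / 2"

definition I_alpha :: "real \<Rightarrow> real set" where
  "I_alpha \<alpha> = {\<alpha> - 2..<\<alpha>}"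

(* Meant for x \<noteq> 0 only; the value at x = 0 is an artefact of division by zero. *)
definition d_alpha :: "real \<Rightarrow> real \<Rightarrow> int" where
  "d_alpha \<alpha> x = 2 * \<lfloor>1 / (2 * \<bar>x\<bar>) + (1 - \<alpha>) / 2\<rfloor> + 1"

definition phi_alpha :: "real \<Rightarrow> real \<Rightarrow> real" where
  "phi_alpha \<alpha> x = (if x = 0 then 0 else 1 / \<bar>x\<bar> - real_of_int (d_alpha \<alpha> x))"

(* Likewise meant for x \<noteq> 0 only. *)
definition Phi_alpha :: "real \<Rightarrow> real \<times> real \<Rightarrow> real \<times> real" where
  "Phi_alpha \<alpha> = (\<lambda>(x, y). (phi_alpha \<alpha> x, 1 / (real_of_int (d_alpha \<alpha> x) + sgn x * y)))"

definition Omega_I :: "real \<Rightarrow> (real \<times> real) set" where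
  "Omega_I \<alpha> = I_alpha \<alpha> \<times> {0..<2 - gold_G}"

definition Omega_II :: "real \<Rightarrow> (real \<times> real) set" where
  "Omega_II \<alpha> = {phi_alpha \<alpha> \<alpha><..<\<alpha>} \<times> {2 - gold_G<..1}"

definition Omega_III :: "real \<Rightarrow> (real \<times> real) set" where
  "Omega_III \<alpha> = {phi_alpha \<alpha> (\<alpha> - 2)..<\<alpha>} \<times> {1..<gold_G}"

definition Omega :: "real \<Rightarrow> (real \<times> real) set" where
  "Omega \<alpha> = Omega_I \<alpha> \<union> Omega_II \<alpha> \<union> Omega_III \<alpha>"

definition Omega_1 :: "real \<Rightarrow> (real \<times> real) set" where
  "Omega_1 \<alpha> = {\<alpha> - 2..<- (1 / (1 + \<alpha>))} \<times> {0..<2 - gold_G}"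

definition Omega_2 :: "real \<Rightarrow> (real \<times> real) set" where
  "Omega_2 \<alpha> = {1 / (1 + \<alpha>)<..<\<alpha>} \<times> {0..<gold_G}"

definition Omega_3 :: "real \<Rightarrow> (real \<times> real) set" where
  "Omega_3 \<alpha> = {- (1 / (1 + \<alpha>))..<0} \<times> {0..<2 - gold_G}"

definition Omega_4 :: "real \<Rightarrow> (real \<times> real) set" where
  "Omega_4 \<alpha> = {0<..1 / (1 + \<alpha>)} \<times> {0..<2 - gold_G}"

definition Omega_5 :: "real \<Rightarrow> (real \<times> real) set" where
  "Omega_5 \<alpha> = {0<..1 / (1 + \<alpha>)} \<times> {1..<gold_G}"

definition Omega_6 :: "real \<Rightarrow> (real \<times> real) set" where
  "Omega_6 \<alpha> = {phi_alpha \<alpha> \<alpha><..1 / (1 + \<alpha>)} \<times> {2 - gold_G..<1}"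

definition Omega_7 :: "real \<Rightarrow> (real \<times> real) set" where
  "Omega_7 \<alpha> = {phi_alpha \<alpha> (\<alpha> - 2)..<0} \<times> {1..<gold_G}"

(* The part of Omega on which Phi_alpha is undefined (x = 0) has to be among the
   removed points. *)
definition Phi_bij_upto_null :: "real \<Rightarrow> bool" where
  "Phi_bij_upto_null \<alpha> \<longleftrightarrow>
     (\<exists>N1 N2. N1 \<in> null_sets lebesgue \<and> N2 \<in> null_sets lebesgue \<and>
        {p \<in> Omega \<alpha>. fst p = 0} \<subseteq> N1 \<and>
        bij_betw (Phi_alpha \<alpha>) (Omega \<alpha> - N1) (Omega \<alpha> - N2))"

end

theory Submission
  imports Defs
begin

text \<open>
  Every nonzero \<open>x\<close> is \<open>e / (2 k + 1 + u)\<close> with \<open>e = sgn x\<close>, digit \<open>2 k + 1\<close>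
  and \<open>u = \<phi>(x)\<close> in \<open>I\<^sub>\<alpha>\<close>, and then \<open>\<Phi>(x, y) = (u, 1 / (2 k + 1 + e y))\<close>.
  On a rectangle of constant sign, \<open>\<Phi>\<close> is therefore a union over \<open>k\<close> of product maps,
  which gives all the images. Up to countably many horizontal lines these images cover
  \<open>\<Omega>\<close>. For injectivity, two preimages of one point with opposite signs would have adjacent
  digits and heights adding up to 2, so that the positive one would lie to the right of
  \<open>\<phi>(\<alpha>)\<close> and the negative one to the right of \<open>\<phi>(\<alpha> - 2)\<close>. This is
  impossible, because \<open>1 / \<phi>(\<alpha>)\<close> and \<open>- 1 / \<phi>(\<alpha> - 2)\<close> differ by exactly 2.
\<close>

section \<open>Arithmetic of the golden ratio\<close>

lemma gold_G_props:
  shows gold_G_square: "gold_G * gold_G = gold_G + 1"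
    and gold_G_gt: "gold_G > 1.6"
    and gold_G_lt: "gold_G < 1.7"
    and gold_g_eq: "gold_g = gold_G - 1"
proof -
  show "gold_G * gold_G = gold_G + 1"
    by (simp add: gold_G_def field_simps)
  have "sqrt 5 > 2.2" "sqrt 5 < 2.4"
    by (rule real_less_rsqrt real_less_lsqrt; simp add: power2_eq_square)+
  then show "gold_G > 1.6" "gold_G < 1.7"
    by (simp_all add: gold_G_def)
  show "gold_g = gold_G - 1"
    by (simp add: gold_g_def gold_G_def field_simps)
qed

text \<open>Together with the next identity this explains the height breakpoints of
  \<open>Omega\<close>: with digit 1, heights up to G at positive x are sent down to 2 - G, and
  heights up to 2 - G at negative x are sent up to 1 / (1 - (2 - G)) = G.\<close>

lemma inverse_gold_G_plus_1: "1 / (1 + gold_G) = 2 - gold_G"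
  using gold_G_square gold_G_gt by (simp add: field_simps)

lemma inverse_gold_G_minus_1: "1 / (gold_G - 1) = gold_G"
  using gold_G_square gold_G_gt by (simp add: field_simps)

section \<open>Inverse branches and images of rectangles\<close>

text \<open>\<open>I_alpha \<alpha>\<close> has length 2, so its translates by odd integers tile the
  line. The floor in \<open>d_alpha\<close> picks the tile that contains 1 / |x|.\<close>

lemma d_alpha_eq_iff:
  assumes "x \<noteq> 0"
  shows "d_alpha \<alpha> x = 2 * k + 1 \<longleftrightarrow> 1 / \<bar>x\<bar> - (2 * real_of_int k + 1) \<in> I_alpha \<alpha>"
proof -
  have *: "1 / (2 * \<bar>x\<bar>) = (1 / \<bar>x\<bar>) / 2"
    by simp
  have "d_alpha \<alpha> x = 2 * k + 1 \<longleftrightarrow> \<lfloor>1 / (2 * \<bar>x\<bar>) + (1 - \<alpha>) / 2\<rfloor> = k"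
    by (simp add: d_alpha_def)
  also have "\<dots> \<longleftrightarrow> 1 / \<bar>x\<bar> - (2 * real_of_int k + 1) \<in> I_alpha \<alpha>"
    unfolding * floor_eq_iff I_alpha_def atLeastLessThan_iff by (simp add: field_simps)
  finally show ?thesis .
qed

text \<open>Here 1 / |x| = 2 k + 1 + u with u in \<open>I_alpha \<alpha>\<close>, and by the tiling
  the digit and the remainder can be read off. The sign of x is e because the denominator is
  positive.\<close>

lemma Phi_alpha_inverse_branch:
  fixes k :: int
  assumes "\<bar>e\<bar> = 1" "u \<in> I_alpha \<alpha>" "2 * real_of_int k + 1 + u > 0"
  shows "Phi_alpha \<alpha> (e / (2 * real_of_int k + 1 + u), y) = (u, 1 / (2 * real_of_int k + 1 + e * y))"
proof -
  define x where "x = e / (2 * real_of_int k + 1 + u)"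
  have e: "e = 1 \<or> e = -1"
    using assms(1) by linarith
  have nz: "x \<noteq> 0" and sgn: "sgn x = e"
    using assms(3) e by (auto simp: x_def sgn_if divide_simps)
  have inv: "1 / \<bar>x\<bar> = 2 * real_of_int k + 1 + u"
    using assms(1,3) by (simp add: x_def abs_div_pos)
  have "d_alpha \<alpha> x = 2 * k + 1"
    using d_alpha_eq_iff[OF nz] assms(2) by (simp add: inv)
  then show ?thesis
    unfolding x_def[symmetric] by (simp add: Phi_alpha_def phi_alpha_def nz sgn inv)
qed

lemma obtain_inverse_branch:
  assumes "x \<noteq> 0"
  obtains k :: int and u where "u \<in> I_alpha \<alpha>" "2 * real_of_int k + 1 + u > 0"
    "x = sgn x / (2 * real_of_int k + 1 + u)"
proof -
  obtain k where k: "d_alpha \<alpha> x = 2 * k + 1"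
    by (simp add: d_alpha_def)
  define u where "u = 1 / \<bar>x\<bar> - (2 * real_of_int k + 1)"
  have inv: "2 * real_of_int k + 1 + u = 1 / \<bar>x\<bar>"
    by (simp add: u_def)
  show ?thesis
  proof (rule that)
    show "u \<in> I_alpha \<alpha>"
      using k d_alpha_eq_iff[OF assms] u_def by blast
    show "2 * real_of_int k + 1 + u > 0" "x = sgn x / (2 * real_of_int k + 1 + u)"
      unfolding inv using assms by (simp_all add: sgn_mult_abs)
  qed
qed

text \<open>For e = 1 or e = -1 this is the image under \<open>phi_alpha \<alpha>\<close> of the
  points of X that have sign e and digit 2 k + 1. Writing it through the inverse branch turns its
  computation into inequalities for 2 k + 1 + u.\<close>

definition branch_domain :: "real \<Rightarrow> real \<Rightarrow> real set \<Rightarrow> int \<Rightarrow> real set" where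
  "branch_domain \<alpha> e X k =
     {u \<in> I_alpha \<alpha>. 2 * real_of_int k + 1 + u > 0 \<and> e / (2 * real_of_int k + 1 + u) \<in> X}"

text \<open>Once sign and digit are fixed, the first coordinate of the image depends on x alone and
  the second on y alone, so each branch contributes a product.\<close>

lemma Phi_alpha_image_rectangle:
  assumes "\<bar>e\<bar> = 1" "\<And>x. x \<in> X \<Longrightarrow> sgn x = e"
  shows "Phi_alpha \<alpha> ` (X \<times> Y) =
    (\<Union>k. branch_domain \<alpha> e X k \<times> (\<lambda>y. 1 / (2 * real_of_int k + 1 + e * y)) ` Y)"
    (is "?L = ?R")
proof
  show "?L \<subseteq> ?R"
  proof
    fix p assume "p \<in> ?L"
    then obtain x y where xy: "x \<in> X" "y \<in> Y" "p = Phi_alpha \<alpha> (x, y)"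
      by auto
    have sgn: "sgn x = e"
      by (rule assms(2)) fact
    then have "x \<noteq> 0"
      using assms(1) by auto
    then obtain k u where ku: "u \<in> I_alpha \<alpha>" "2 * real_of_int k + 1 + u > 0"
        "x = sgn x / (2 * real_of_int k + 1 + u)"
      by (rule obtain_inverse_branch)
    have "p = (u, 1 / (2 * real_of_int k + 1 + e * y))"
      using Phi_alpha_inverse_branch[OF assms(1) ku(1,2), of y] xy(3) ku(3) by (simp add: sgn)
    moreover have "u \<in> branch_domain \<alpha> e X k"
      using ku xy(1) by (simp add: branch_domain_def sgn)
    ultimately show "p \<in> ?R"
      using xy(2) by blast
  qed
  show "?R \<subseteq> ?L"
  proof
    fix p assume "p \<in> ?R"
    then obtain k u y where p: "u \<in> branch_domain \<alpha> e X k" "y \<in> Y"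
        "p = (u, 1 / (2 * real_of_int k + 1 + e * y))"
      by auto
    then have "p = Phi_alpha \<alpha> (e / (2 * real_of_int k + 1 + u), y)"
      using Phi_alpha_inverse_branch[OF assms(1)] by (simp add: branch_domain_def)
    with p(1,2) show "p \<in> ?L"
      by (auto simp: branch_domain_def)
  qed
qed

text \<open>The map decreases in y, so the closed end of the interval changes sides; in the
  reflected version below it increases and the closed end stays on the left. The factors 1 and -1
  are the signs e of the branches.\<close>

lemma image_inverse_shift:
  fixes a b c :: real
  assumes "0 < c + a" "a < b"
  shows "(\<lambda>y. 1 / (c + 1 * y)) ` {a..<b} = {1 / (c + b)<..1 / (c + a)}"
proof (intro equalityI subsetI)
  fix v assume "v \<in> {1 / (c + b)<..1 / (c + a)}"
  moreover have "0 < 1 / (c + b)"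
    using assms by simp
  ultimately have v: "0 < v" "1 / (c + b) < v" "v \<le> 1 / (c + a)"
    unfolding greaterThanAtMost_iff by linarith+
  have "1 / v - c \<in> {a..<b}"
    using v assms by (auto simp: field_simps)
  moreover have "v = 1 / (c + 1 * (1 / v - c))"
    by simp
  ultimately show "v \<in> (\<lambda>y. 1 / (c + 1 * y)) ` {a..<b}"
    by blast
qed (use assms in \<open>auto simp: frac_less2 frac_le\<close>)

lemma image_inverse_reflect:
  fixes a b c :: real
  assumes "0 < c - b" "a < b"
  shows "(\<lambda>y. 1 / (c + -1 * y)) ` {a..<b} = {1 / (c - a)..<1 / (c - b)}"
proof (intro equalityI subsetI)
  fix v assume "v \<in> {1 / (c - a)..<1 / (c - b)}"
  moreover have "0 < 1 / (c - a)"
    using assms by simp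
  ultimately have v: "0 < v" "1 / (c - a) \<le> v" "v < 1 / (c - b)"
    unfolding atLeastLessThan_iff by linarith+
  have "c - 1 / v \<in> {a..<b}"
    using v assms by (auto simp: field_simps)
  moreover have "v = 1 / (c + -1 * (c - 1 / v))"
    by simp
  ultimately show "v \<in> (\<lambda>y. 1 / (c + -1 * y)) ` {a..<b}"
    by blast
qed (use assms in \<open>auto simp: frac_less2 frac_le\<close>)

section \<open>The endpoints of \<open>I_alpha\<close> and their orbits\<close>

lemma alpha_bounds:
  assumes "gold_g < \<alpha>" "\<alpha> < 1"
  shows "0.6 < \<alpha>" "1 - \<alpha> * \<alpha> < \<alpha>"
proof -
  show "0.6 < \<alpha>"
    using assms gold_g_eq gold_G_gt by linarith
  \<comment> \<open>G - 1 = g and -G are the roots of t^2 + t - 1, so the second bound is the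
    hypothesis g < \<alpha> in quadratic form.\<close>
  have "(\<alpha> - (gold_G - 1)) * (\<alpha> + gold_G) > 0"
    using assms gold_g_eq gold_G_gt by simp
  then show "1 - \<alpha> * \<alpha> < \<alpha>"
    using gold_G_square by (simp add: algebra_simps)
qed

lemma phi_alpha_eq:
  assumes "x \<noteq> 0" "1 / \<bar>x\<bar> - (2 * real_of_int k + 1) \<in> I_alpha \<alpha>"
  shows "phi_alpha \<alpha> x = 1 / \<bar>x\<bar> - (2 * real_of_int k + 1)"
  using assms d_alpha_eq_iff[of x \<alpha> k] by (simp add: phi_alpha_def)

text \<open>Both endpoints have digit 1. For \<alpha> this needs 1 / \<alpha> - 1 < \<alpha>, which
  is the inequality 1 - \<alpha>^2 < \<alpha>.\<close>

lemma phi_alpha_endpoints: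
  assumes "gold_g < \<alpha>" "\<alpha> < 1"
  shows phi_alpha_right: "phi_alpha \<alpha> \<alpha> = 1 / \<alpha> - 1"
    and phi_alpha_left: "phi_alpha \<alpha> (\<alpha> - 2) = 1 / (2 - \<alpha>) - 1"
proof -
  note bnd = alpha_bounds[OF assms] assms
  have sq: "\<alpha> * \<alpha> < 1"
    using mult_strict_mono[of \<alpha> 1 \<alpha> 1] bnd by simp
  then have "1 / \<alpha> - 1 \<in> I_alpha \<alpha>"
    using bnd by (auto simp: I_alpha_def field_simps)
  then show "phi_alpha \<alpha> \<alpha> = 1 / \<alpha> - 1"
    using phi_alpha_eq[of \<alpha> 0 \<alpha>] bnd by simp
  have "(1 - \<alpha>) * (2 - \<alpha>) \<le> 1"
    using mult_mono[of "1 - \<alpha>" "0.4" "2 - \<alpha>" "2"] bnd by simp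
  moreover have "0 < (2 - \<alpha>) * (1 + \<alpha>) - 1"
    using bnd sq by (simp add: algebra_simps)
  ultimately have "1 / (2 - \<alpha>) - 1 \<in> I_alpha \<alpha>"
    using bnd by (auto simp: I_alpha_def field_simps)
  then show "phi_alpha \<alpha> (\<alpha> - 2) = 1 / (2 - \<alpha>) - 1"
    using phi_alpha_eq[of "\<alpha> - 2" 0 \<alpha>] bnd by simp
qed

text \<open>The last two equations are why the branch cut off in \<open>\<Omega>\<^sub>6\<close> fits together with
  the one cut off in \<open>\<Omega>\<^sub>7\<close>.\<close>

lemma phi_alpha_orbits:
  fixes K :: int
  assumes "gold_g < \<alpha>" "\<alpha> < 1" "2 * K + 1 = d_alpha \<alpha> (phi_alpha \<alpha> \<alpha>)"
  defines "\<gamma> \<equiv> phi_alpha \<alpha> (phi_alpha \<alpha> \<alpha>)"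
  shows "\<gamma> \<in> I_alpha \<alpha>" "K \<ge> 1"
    "0 < 2 * real_of_int K + 1 + \<gamma>"
    "phi_alpha \<alpha> \<alpha> = 1 / (2 * real_of_int K + 1 + \<gamma>)"
    "phi_alpha \<alpha> (\<alpha> - 2) = - (1 / (2 * real_of_int K + 3 + \<gamma>))"
proof -
  note bnd = alpha_bounds[OF assms(1,2)] assms(2)
  define \<beta> where "\<beta> = phi_alpha \<alpha> \<alpha>"
  have \<beta>: "\<beta> = 1 / \<alpha> - 1"
    unfolding \<beta>_def by (rule phi_alpha_right) fact+
  have \<beta>_pos: "0 < \<beta>"
    using bnd by (simp add: \<beta> field_simps)
  have d: "d_alpha \<alpha> \<beta> = 2 * K + 1"
    using assms(3) by (simp add: \<beta>_def)
  have \<gamma>: "\<gamma> = 1 / \<beta> - (2 * real_of_int K + 1)"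
    using \<beta>_pos d by (simp add: \<gamma>_def \<beta>_def[symmetric] phi_alpha_def[of _ \<beta>])
  show \<gamma>_I: "\<gamma> \<in> I_alpha \<alpha>"
    using d d_alpha_eq_iff[of \<beta> \<alpha> K] \<beta>_pos by (simp add: \<gamma>)
  have inv: "2 * real_of_int K + 1 + \<gamma> = 1 / \<beta>"
    by (simp add: \<gamma>)
  show "0 < 2 * real_of_int K + 1 + \<gamma>" "phi_alpha \<alpha> \<alpha> = 1 / (2 * real_of_int K + 1 + \<gamma>)"
    using \<beta>_pos by (simp_all add: inv \<beta>_def)
  have "1 / \<beta> = \<alpha> / (1 - \<alpha>)"
    using bnd by (simp add: \<beta> field_simps)
  \<comment> \<open>The quadratic bound once more: 1 - \<alpha>^2 < \<alpha> divided by 1 -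
    \<alpha>. Since \<gamma> < \<alpha>, it forces K > 0.\<close>
  moreover have "1 + \<alpha> < \<alpha> / (1 - \<alpha>)"
    using bnd by (simp add: field_simps)
  ultimately have "real_of_int K > 0" and *: "2 * real_of_int K + 3 + \<gamma> = \<alpha> / (1 - \<alpha>) + 2"
    using inv \<gamma>_I by (auto simp: I_alpha_def)
  then show "K \<ge> 1"
    by simp
  have "phi_alpha \<alpha> (\<alpha> - 2) = 1 / (2 - \<alpha>) - 1"
    by (rule phi_alpha_left) fact+
  \<comment> \<open>Both sides equal -(1 - \<alpha>) / (2 - \<alpha>), because \<alpha> / (1 -
    \<alpha>) + 2 = (2 - \<alpha>) / (1 - \<alpha>).\<close>
  also have "\<dots> = - (1 / (2 * real_of_int K + 3 + \<gamma>))"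
    unfolding * using bnd by (simp add: field_simps)
  finally show "phi_alpha \<alpha> (\<alpha> - 2) = - (1 / (2 * real_of_int K + 3 + \<gamma>))" .
qed

section \<open>Branch domains of the first five rectangles\<close>

text \<open>The interval of heights is only asked for on branches that occur; on the others the
  denominators may vanish or change sign, and the product is empty anyway.\<close>

lemma Phi_alpha_image_eq:
  assumes "\<bar>e\<bar> = 1" "\<And>x. x \<in> X \<Longrightarrow> sgn x = e"
    and "\<And>k. branch_domain \<alpha> e X k = B k"
    and "\<And>k. B k \<noteq> {} \<Longrightarrow> (\<lambda>y. 1 / (2 * real_of_int k + 1 + e * y)) ` Y = J k"
  shows "Phi_alpha \<alpha> ` (X \<times> Y) = (\<Union>k. B k \<times> J k)"
proof -
  have "B k \<times> (\<lambda>y. 1 / (2 * real_of_int k + 1 + e * y)) ` Y = B k \<times> J k" for k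
    by (cases "B k = {}") (simp_all add: assms(4))
  then show ?thesis
    by (simp add: Phi_alpha_image_rectangle[OF assms(1,2)] assms(3))
qed

text \<open>For fixed k the values 2 k + 1 + u fill [2 k - 1 + \<alpha>, 2 k + 1 + \<alpha>). Hence
  1 + \<alpha> is the border between digit 1 and the larger digits, which is why the rectangles are
  cut at |x| = 1 / (1 + \<alpha>).\<close>

lemma branch_index:
  fixes k :: int
  assumes "u \<in> I_alpha \<alpha>" "\<alpha> < 1"
  shows "0 < 2 * real_of_int k + 1 + u \<Longrightarrow> k \<ge> 0"
    and "1 + \<alpha> \<le> 2 * real_of_int k + 1 + u \<longleftrightarrow> k \<ge> 1"
proof -
  have u: "\<alpha> - 2 \<le> u" "u < \<alpha>"
    using assms(1) by (auto simp: I_alpha_def)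
  have small: "real_of_int k \<le> -1" if "k < 0"
    using that by linarith
  show "k \<ge> 0" if "0 < 2 * real_of_int k + 1 + u"
    using small that u assms(2) by linarith
  have "real_of_int k \<ge> 1 \<or> real_of_int k \<le> 0"
    by (cases "k \<ge> 1") auto
  moreover have "real_of_int k \<ge> 1 \<longleftrightarrow> k \<ge> 1"
    by simp
  ultimately show "1 + \<alpha> \<le> 2 * real_of_int k + 1 + u \<longleftrightarrow> k \<ge> 1"
    using u by linarith
qed

lemma branch_domain_eqI:
  assumes "\<And>u. u \<in> I_alpha \<alpha> \<Longrightarrow> 0 < 2 * real_of_int k + 1 + u \<Longrightarrow>
      e / (2 * real_of_int k + 1 + u) \<in> X \<longleftrightarrow> u \<in> B"
    and "\<And>u. u \<in> B \<Longrightarrow> u \<in> I_alpha \<alpha> \<and> 0 < 2 * real_of_int k + 1 + u"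
  shows "branch_domain \<alpha> e X k = B"
  using assms unfolding branch_domain_def by blast

lemma inverse_le_inverse_iff:
  fixes s t :: real
  assumes "0 < s" "0 < t"
  shows "1 / s \<le> 1 / t \<longleftrightarrow> t \<le> s" "1 / s < 1 / t \<longleftrightarrow> t < s"
  using assms by (auto simp: field_simps)

context
  fixes \<alpha> :: real
  assumes \<alpha>_gt: "gold_g < \<alpha>" and \<alpha>_lt: "\<alpha> < 1"
begin

lemmas bounds = alpha_bounds[OF \<alpha>_gt \<alpha>_lt] \<alpha>_lt

lemma branch_domain_1:
  "branch_domain \<alpha> (-1) {\<alpha> - 2..<- (1 / (1 + \<alpha>))} k = (if k = 0 then {phi_alpha \<alpha> (\<alpha> - 2)..<\<alpha>} else {})"
proof (rule branch_domain_eqI)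
  fix u assume u: "u \<in> I_alpha \<alpha>" and pos: "0 < 2 * real_of_int k + 1 + u"
  note k = branch_index(1)[OF u \<alpha>_lt pos] branch_index(2)[OF u \<alpha>_lt, of k]
  have "-1 / t \<in> {\<alpha> - 2..<- (1 / (1 + \<alpha>))} \<longleftrightarrow> 1 / (2 - \<alpha>) \<le> t \<and> t < 1 + \<alpha>" if "0 < t" for t
    using that bounds by (auto simp: field_simps)
  from this[OF pos] show "-1 / (2 * real_of_int k + 1 + u) \<in> {\<alpha> - 2..<- (1 / (1 + \<alpha>))} \<longleftrightarrow> u \<in> (if k = 0 then {phi_alpha \<alpha> (\<alpha> - 2)..<\<alpha>} else {})"
    using k u by (auto simp: I_alpha_def phi_alpha_left[OF \<alpha>_gt \<alpha>_lt])
next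
  fix u assume u: "u \<in> (if k = 0 then {phi_alpha \<alpha> (\<alpha> - 2)..<\<alpha>} else {})"
  then have "k = 0" and u': "1 / (2 - \<alpha>) - 1 \<le> u" "u < \<alpha>"
    by (auto simp: phi_alpha_left[OF \<alpha>_gt \<alpha>_lt] split: if_splits)
  \<comment> \<open>The resulting crude bound u \<ge> -1/2 gives both 1 + u > 0 and u \<ge> \<alpha>
    - 2.\<close>
  have "1 / 2 \<le> 1 / (2 - \<alpha>)"
    using bounds by (simp add: field_simps)
  with u'(1) have "- 1 / 2 \<le> u"
    by linarith
  then show "u \<in> I_alpha \<alpha> \<and> 0 < 2 * real_of_int k + 1 + u"
    using u' bounds \<alpha>_lt \<open>k = 0\<close> by (simp add: I_alpha_def)
qed

lemma branch_domain_2: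
  "branch_domain \<alpha> (1) {1 / (1 + \<alpha>)<..<\<alpha>} k = (if k = 0 then {phi_alpha \<alpha> \<alpha><..<\<alpha>} else {})"
proof (rule branch_domain_eqI)
  fix u assume u: "u \<in> I_alpha \<alpha>" and pos: "0 < 2 * real_of_int k + 1 + u"
  note k = branch_index(1)[OF u \<alpha>_lt pos] branch_index(2)[OF u \<alpha>_lt, of k]
  have "1 / t \<in> {1 / (1 + \<alpha>)<..<\<alpha>} \<longleftrightarrow> 1 / \<alpha> < t \<and> t < 1 + \<alpha>" if "0 < t" for t
    using that bounds by (auto simp: field_simps)
  from this[OF pos] show "1 / (2 * real_of_int k + 1 + u) \<in> {1 / (1 + \<alpha>)<..<\<alpha>} \<longleftrightarrow> u \<in> (if k = 0 then {phi_alpha \<alpha> \<alpha><..<\<alpha>} else {})"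
    using k u by (auto simp: I_alpha_def phi_alpha_right[OF \<alpha>_gt \<alpha>_lt])
next
  fix u assume u: "u \<in> (if k = 0 then {phi_alpha \<alpha> \<alpha><..<\<alpha>} else {})"
  then have "k = 0" and u': "1 / \<alpha> - 1 < u" "u < \<alpha>"
    by (auto simp: phi_alpha_right[OF \<alpha>_gt \<alpha>_lt] split: if_splits)
  have "1 < 1 / \<alpha>"
    using bounds by simp
  with u'(1) have "- 1 / 2 \<le> u"
    by linarith
  then show "u \<in> I_alpha \<alpha> \<and> 0 < 2 * real_of_int k + 1 + u"
    using u' bounds \<open>k = 0\<close> by (simp add: I_alpha_def)
qed

text \<open>On this side of the cut every digit from 3 on occurs with a full branch: neither end of
  the x-interval cuts into a tile.\<close>

lemma branch_domain_3:
  "branch_domain \<alpha> (-1) {- (1 / (1 + \<alpha>))..<0} k = (if k \<ge> 1 then I_alpha \<alpha> else {})"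
proof (rule branch_domain_eqI)
  fix u assume u: "u \<in> I_alpha \<alpha>" and pos: "0 < 2 * real_of_int k + 1 + u"
  note k = branch_index(1)[OF u \<alpha>_lt pos] branch_index(2)[OF u \<alpha>_lt, of k]
  have "-1 / t \<in> {- (1 / (1 + \<alpha>))..<0} \<longleftrightarrow> 1 + \<alpha> \<le> t" if "0 < t" for t
    using that bounds by (auto simp: field_simps)
  from this[OF pos] show "-1 / (2 * real_of_int k + 1 + u) \<in> {- (1 / (1 + \<alpha>))..<0} \<longleftrightarrow> u \<in> (if k \<ge> 1 then I_alpha \<alpha> else {})"
    using k u by simp
next
  fix u assume u: "u \<in> (if k \<ge> 1 then I_alpha \<alpha> else {})"
  then have "u \<in> I_alpha \<alpha>" "k \<ge> 1"
    by (auto split: if_splits)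
  then show "u \<in> I_alpha \<alpha> \<and> 0 < 2 * real_of_int k + 1 + u"
    using branch_index(2)[of u \<alpha> k] bounds by linarith
qed

text \<open>\<open>Omega_4\<close> and \<open>Omega_5\<close> have the same x-interval, so this
  serves both.\<close>

lemma branch_domain_4:
  "branch_domain \<alpha> (1) {0<..1 / (1 + \<alpha>)} k = (if k \<ge> 1 then I_alpha \<alpha> else {})"
proof (rule branch_domain_eqI)
  fix u assume u: "u \<in> I_alpha \<alpha>" and pos: "0 < 2 * real_of_int k + 1 + u"
  note k = branch_index(1)[OF u \<alpha>_lt pos] branch_index(2)[OF u \<alpha>_lt, of k]
  have "1 / t \<in> {0<..1 / (1 + \<alpha>)} \<longleftrightarrow> 1 + \<alpha> \<le> t" if "0 < t" for t
    using that bounds by (auto simp: field_simps)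
  from this[OF pos] show "1 / (2 * real_of_int k + 1 + u) \<in> {0<..1 / (1 + \<alpha>)} \<longleftrightarrow> u \<in> (if k \<ge> 1 then I_alpha \<alpha> else {})"
    using k u by simp
next
  fix u assume u: "u \<in> (if k \<ge> 1 then I_alpha \<alpha> else {})"
  then have "u \<in> I_alpha \<alpha>" "k \<ge> 1"
    by (auto split: if_splits)
  then show "u \<in> I_alpha \<alpha> \<and> 0 < 2 * real_of_int k + 1 + u"
    using branch_index(2)[of u \<alpha> k] bounds by linarith
qed

section \<open>Images of the first five rectangles\<close>

lemma Phi_image_1: "Phi_alpha \<alpha> ` Omega_1 \<alpha> = Omega_III \<alpha>"
proof -
  have "Phi_alpha \<alpha> ` Omega_1 \<alpha> =
      (\<Union>k::int. (if k = 0 then {phi_alpha \<alpha> (\<alpha> - 2)..<\<alpha>} else {}) \<times> {1..<gold_G})"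
    unfolding Omega_1_def
  proof (rule Phi_alpha_image_eq[OF _ _ branch_domain_1])
    show "(\<lambda>y. 1 / (2 * real_of_int k + 1 + - 1 * y)) ` {0..<2 - gold_G} = {1..<gold_G}"
      if "(if k = 0 then {phi_alpha \<alpha> (\<alpha> - 2)..<\<alpha>} else {}) \<noteq> {}" for k
    proof -
      have "k = 0"
        using that by presburger
      then show ?thesis
        using image_inverse_reflect[of 1 "2 - gold_G" 0] gold_G_gt gold_G_lt inverse_gold_G_minus_1
        by simp
    qed
    show "sgn x = -1" if "x \<in> {\<alpha> - 2..<- (1 / (1 + \<alpha>))}" for x
    proof -
      have "x < - (1 / (1 + \<alpha>))"
        using that by simp
      also have "\<dots> < 0"
        using bounds by simp
      finally show ?thesis
        by simp
    qed
  qed simp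
  then show ?thesis
    by (auto simp: Omega_III_def split: if_splits)
qed

lemma Phi_image_2: "Phi_alpha \<alpha> ` Omega_2 \<alpha> = Omega_II \<alpha>"
proof -
  have "Phi_alpha \<alpha> ` Omega_2 \<alpha> =
      (\<Union>k::int. (if k = 0 then {phi_alpha \<alpha> \<alpha><..<\<alpha>} else {}) \<times> {2 - gold_G<..1})"
    unfolding Omega_2_def
  proof (rule Phi_alpha_image_eq[OF _ _ branch_domain_2])
    show "(\<lambda>y. 1 / (2 * real_of_int k + 1 + 1 * y)) ` {0..<gold_G} = {2 - gold_G<..1}"
      if "(if k = 0 then {phi_alpha \<alpha> \<alpha><..<\<alpha>} else {}) \<noteq> {}" for k
    proof -
      have "k = 0"
        using that by presburger
      then show ?thesis
        using image_inverse_shift[of 1 0 gold_G] gold_G_gt inverse_gold_G_plus_1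
        by simp
    qed
    show "sgn x = 1" if "x \<in> {1 / (1 + \<alpha>)<..<\<alpha>}" for x
    proof -
      have "0 < 1 / (1 + \<alpha>)"
        using bounds by simp
      also have "\<dots> < x"
        using that by simp
      finally show ?thesis
        by simp
    qed
  qed simp
  then show ?thesis
    by (auto simp: Omega_II_def split: if_splits)
qed

lemma Phi_image_3:
  "Phi_alpha \<alpha> ` Omega_3 \<alpha> = I_alpha \<alpha> \<times>
    (\<Union>k\<in>{1::int..}. {1 / (2 * real_of_int k + 1)..<1 / (2 * real_of_int k - 1 + gold_G)})"
proof -
  have "Phi_alpha \<alpha> ` Omega_3 \<alpha> = (\<Union>k. (if k \<ge> 1 then I_alpha \<alpha> else {}) \<times>
      {1 / (2 * real_of_int k + 1)..<1 / (2 * real_of_int k - 1 + gold_G)})"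
    unfolding Omega_3_def
  proof (rule Phi_alpha_image_eq[OF _ _ branch_domain_3])
    fix k :: int
    assume "(if k \<ge> 1 then I_alpha \<alpha> else {}) \<noteq> {}"
    then have "real_of_int k \<ge> 1"
      by (simp split: if_splits)
    \<comment> \<open>The denominator at the upper height 2 - G is 2 k - 1 + G, which is where the
      right end of the image interval comes from.\<close>
    then have pos: "0 < 2 * real_of_int k + 1 - (2 - gold_G)"
      using gold_G_gt by linarith
    show "(\<lambda>y. 1 / (2 * real_of_int k + 1 + - 1 * y)) ` {0..<2 - gold_G} =
        {1 / (2 * real_of_int k + 1)..<1 / (2 * real_of_int k - 1 + gold_G)}"
      using image_inverse_reflect[of "2 * real_of_int k + 1" "2 - gold_G" 0, OF pos] gold_G_lt
      by (simp add: algebra_simps)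
  qed auto
  then show ?thesis
    by (auto split: if_splits)
qed

lemma Phi_image_4:
  "Phi_alpha \<alpha> ` Omega_4 \<alpha> = I_alpha \<alpha> \<times>
    (\<Union>k\<in>{1::int..}. {1 / (2 * real_of_int k + 3 - gold_G)<..1 / (2 * real_of_int k + 1)})"
proof -
  have "Phi_alpha \<alpha> ` Omega_4 \<alpha> = (\<Union>k. (if k \<ge> 1 then I_alpha \<alpha> else {}) \<times>
      {1 / (2 * real_of_int k + 3 - gold_G)<..1 / (2 * real_of_int k + 1)})"
    unfolding Omega_4_def
  proof (rule Phi_alpha_image_eq[OF _ _ branch_domain_4])
    fix k :: int
    assume "(if k \<ge> 1 then I_alpha \<alpha> else {}) \<noteq> {}"
    then have "real_of_int k \<ge> 1"
      by (simp split: if_splits)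
    then show "(\<lambda>y. 1 / (2 * real_of_int k + 1 + 1 * y)) ` {0..<2 - gold_G} =
        {1 / (2 * real_of_int k + 3 - gold_G)<..1 / (2 * real_of_int k + 1)}"
      using image_inverse_shift[of "2 * real_of_int k + 1" 0 "2 - gold_G"] gold_G_gt gold_G_lt
      by (simp add: algebra_simps)
  qed auto
  then show ?thesis
    by (auto split: if_splits)
qed

lemma Phi_image_5:
  "Phi_alpha \<alpha> ` Omega_5 \<alpha> = I_alpha \<alpha> \<times>
    (\<Union>k\<in>{1::int..}. {1 / (2 * real_of_int k + 1 + gold_G)<..1 / (2 * real_of_int k + 2)})"
proof -
  have "Phi_alpha \<alpha> ` Omega_5 \<alpha> = (\<Union>k. (if k \<ge> 1 then I_alpha \<alpha> else {}) \<times>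
      {1 / (2 * real_of_int k + 1 + gold_G)<..1 / (2 * real_of_int k + 2)})"
    unfolding Omega_5_def
  proof (rule Phi_alpha_image_eq[OF _ _ branch_domain_4])
    fix k :: int
    assume "(if k \<ge> 1 then I_alpha \<alpha> else {}) \<noteq> {}"
    then have "real_of_int k \<ge> 1"
      by (simp split: if_splits)
    then show "(\<lambda>y. 1 / (2 * real_of_int k + 1 + 1 * y)) ` {1..<gold_G} =
        {1 / (2 * real_of_int k + 1 + gold_G)<..1 / (2 * real_of_int k + 2)}"
      using image_inverse_shift[of "2 * real_of_int k + 1" 1 gold_G] gold_G_gt
      by (simp add: algebra_simps)
  qed auto
  then show ?thesis
    by (auto split: if_splits)
qed

text \<open>Separates the full branches from the single truncated one, which is m = K for
  \<open>Omega_6\<close> and m = K + 1 for \<open>Omega_7\<close>.\<close>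

lemma UN_if_Times:
  assumes "\<not> P m"
  shows "(\<Union>k. (if P k then A else if k = m then A' else {}) \<times> J k) =
    A \<times> (\<Union>k\<in>{k. P k}. J k) \<union> A' \<times> J m"
  using assms by (auto split: if_splits)

section \<open>Images of the two rectangles with a truncated branch\<close>

context
  fixes K :: int
  assumes K: "2 * K + 1 = d_alpha \<alpha> (phi_alpha \<alpha> \<alpha>)"
begin

abbreviation (input) "\<gamma> \<equiv> phi_alpha \<alpha> (phi_alpha \<alpha> \<alpha>)"

lemmas orbits = phi_alpha_orbits[OF \<alpha>_gt \<alpha>_lt K]

lemma phi_alpha_right_pos: "0 < phi_alpha \<alpha> \<alpha>"
  using bounds by (simp add: phi_alpha_right[OF \<alpha>_gt \<alpha>_lt] field_simps)

lemma branch_domain_6: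
  "branch_domain \<alpha> 1 {phi_alpha \<alpha> \<alpha><..1 / (1 + \<alpha>)} k =
    (if 1 \<le> k \<and> k < K then I_alpha \<alpha> else if k = K then {\<alpha> - 2..<\<gamma>} else {})" (is "_ = ?B")
proof (rule branch_domain_eqI)
  fix u assume u: "u \<in> I_alpha \<alpha>" and pos: "0 < 2 * real_of_int k + 1 + u"
  let ?t = "2 * real_of_int k + 1 + u"
  have "phi_alpha \<alpha> \<alpha> < 1 / ?t \<longleftrightarrow> ?t < 2 * real_of_int K + 1 + \<gamma>"
    using inverse_le_inverse_iff(2)[OF orbits(3) pos] by (simp only: orbits(4)[symmetric])
  \<comment> \<open>As u and \<gamma> both lie in an interval of length 2, half-open on the right,
    comparing 2 k + 1 + u with 2 K + 1 + \<gamma> is comparing the pairs (k, u) and (K, \<gamma>)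
    lexicographically.\<close>
  also have "\<dots> \<longleftrightarrow> k < K \<or> k = K \<and> u < \<gamma>"
  proof -
    consider "real_of_int k \<le> real_of_int K - 1" "k < K" | "k = K"
      | "real_of_int k \<ge> real_of_int K + 1" "k > K"
      by (cases k K rule: linorder_cases) auto
    then show ?thesis
      using u orbits(1) by cases (auto simp: I_alpha_def)
  qed
  finally have lower: "phi_alpha \<alpha> \<alpha> < 1 / ?t \<longleftrightarrow> k < K \<or> k = K \<and> u < \<gamma>" .
  have "1 / ?t \<le> 1 / (1 + \<alpha>) \<longleftrightarrow> k \<ge> 1"
    using inverse_le_inverse_iff(1)[OF pos, of "1 + \<alpha>"] branch_index(2)[OF u \<alpha>_lt, of k] bounds
    by linarith
  with lower show "1 / ?t \<in> {phi_alpha \<alpha> \<alpha><..1 / (1 + \<alpha>)} \<longleftrightarrow> u \<in> ?B"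
    using u orbits(2) by (auto simp: I_alpha_def)
next
  fix u assume "u \<in> ?B"
  then have "u \<in> I_alpha \<alpha>" "k \<ge> 1"
    using orbits(1,2) by (auto simp: I_alpha_def split: if_splits)
  then show "u \<in> I_alpha \<alpha> \<and> 0 < 2 * real_of_int k + 1 + u"
    using branch_index(2)[of u \<alpha> k] bounds by linarith
qed

lemma branch_domain_7:
  "branch_domain \<alpha> (-1) {phi_alpha \<alpha> (\<alpha> - 2)..<0} k =
    (if K + 1 < k then I_alpha \<alpha> else if k = K + 1 then {\<gamma>..<\<alpha>} else {})" (is "_ = ?B")
proof (rule branch_domain_eqI)
  fix u assume u: "u \<in> I_alpha \<alpha>" and pos: "0 < 2 * real_of_int k + 1 + u"
  let ?t = "2 * real_of_int k + 1 + u"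
  have "phi_alpha \<alpha> (\<alpha> - 2) \<le> -1 / ?t \<longleftrightarrow> 1 / ?t \<le> 1 / (2 * real_of_int K + 3 + \<gamma>)"
    unfolding orbits(5) by simp
  also have "\<dots> \<longleftrightarrow> 2 * real_of_int K + 3 + \<gamma> \<le> ?t"
    using orbits(3) by (intro inverse_le_inverse_iff(1) pos) linarith
  \<comment> \<open>The same lexicographic comparison, now with (K + 1, \<gamma>), since 2 K + 3 = 2
    (K + 1) + 1.\<close>
  also have "\<dots> \<longleftrightarrow> K + 1 < k \<or> k = K + 1 \<and> \<gamma> \<le> u"
  proof -
    consider "real_of_int k \<le> real_of_int K" "k < K + 1" | "k = K + 1"
      | "real_of_int k \<ge> real_of_int K + 2" "k > K + 1"
      by (cases k "K + 1" rule: linorder_cases) auto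
    then show ?thesis
      using u orbits(1) by cases (auto simp: I_alpha_def)
  qed
  finally show "-1 / ?t \<in> {phi_alpha \<alpha> (\<alpha> - 2)..<0} \<longleftrightarrow> u \<in> ?B"
    using u pos by (auto simp: I_alpha_def)
next
  fix u assume "u \<in> ?B"
  then have "u \<in> I_alpha \<alpha>" "k \<ge> 1"
    using orbits(1,2) by (auto simp: I_alpha_def split: if_splits)
  then show "u \<in> I_alpha \<alpha> \<and> 0 < 2 * real_of_int k + 1 + u"
    using branch_index(2)[of u \<alpha> k] bounds by linarith
qed

lemma Phi_image_6:
  "Phi_alpha \<alpha> ` Omega_6 \<alpha> =
      (I_alpha \<alpha> \<times>
        (\<Union>k\<in>{1..K - 1}. {1 / (2 * real_of_int k + 2)<..1 / (2 * real_of_int k + 3 - gold_G)})) \<union>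
      ({\<alpha> - 2..<\<gamma>} \<times> {1 / (2 * real_of_int K + 2)<..1 / (2 * real_of_int K + 3 - gold_G)})"
proof -
  let ?B = "\<lambda>k. if 1 \<le> k \<and> k < K then I_alpha \<alpha> else if k = K then {\<alpha> - 2..<\<gamma>} else {}"
  have "Phi_alpha \<alpha> ` Omega_6 \<alpha> = (\<Union>k. ?B k \<times>
      {1 / (2 * real_of_int k + 2)<..1 / (2 * real_of_int k + 3 - gold_G)})"
    unfolding Omega_6_def
  proof (rule Phi_alpha_image_eq[OF _ _ branch_domain_6])
    show "sgn x = 1" if "x \<in> {phi_alpha \<alpha> \<alpha><..1 / (1 + \<alpha>)}" for x
    proof -
      have "0 < phi_alpha \<alpha> \<alpha>" "phi_alpha \<alpha> \<alpha> < x"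
        using that phi_alpha_right_pos by simp_all
      then show ?thesis
        by (simp add: sgn_if)
    qed
    fix k :: int
    assume "?B k \<noteq> {}"
    then have "real_of_int k \<ge> 1"
      using orbits(2) by (simp split: if_splits)
    then show "(\<lambda>y. 1 / (2 * real_of_int k + 1 + 1 * y)) ` {2 - gold_G..<1} =
        {1 / (2 * real_of_int k + 2)<..1 / (2 * real_of_int k + 3 - gold_G)}"
      using image_inverse_shift[of "2 * real_of_int k + 1" "2 - gold_G" 1] gold_G_gt gold_G_lt
      by (simp add: algebra_simps)
  qed simp
  also have "\<dots> = I_alpha \<alpha> \<times> (\<Union>k\<in>{k. 1 \<le> k \<and> k < K}.
        {1 / (2 * real_of_int k + 2)<..1 / (2 * real_of_int k + 3 - gold_G)}) \<union>
      {\<alpha> - 2..<\<gamma>} \<times> {1 / (2 * real_of_int K + 2)<..1 / (2 * real_of_int K + 3 - gold_G)}"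
    by (rule UN_if_Times) simp
  also have "{k. 1 \<le> k \<and> k < K} = {1..K - 1}"
    by auto
  finally show ?thesis .
qed

lemma Phi_image_7:
  "Phi_alpha \<alpha> ` Omega_7 \<alpha> =
      (I_alpha \<alpha> \<times>
        (\<Union>k\<in>{K + 1..}. {1 / (2 * real_of_int k + 2)..<1 / (2 * real_of_int k + 3 - gold_G)})) \<union>
      ({\<gamma>..<\<alpha>} \<times> {1 / (2 * real_of_int K + 2)..<1 / (2 * real_of_int K + 3 - gold_G)})"
proof -
  let ?B = "\<lambda>k. if K + 1 < k then I_alpha \<alpha> else if k = K + 1 then {\<gamma>..<\<alpha>} else {}"
  let ?J = "\<lambda>k. {1 / (2 * real_of_int k + 2)..<1 / (2 * real_of_int k + 3 - gold_G)}"
  \<comment> \<open>At negative x the heights from 1 to G under digit 2 k + 1 start at 1 / (2 k),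
    the level of index k - 1 in the numbering used for \<open>Omega_6\<close>. This shift is undone
    by the reindexing below.\<close>
  have "Phi_alpha \<alpha> ` Omega_7 \<alpha> = (\<Union>k. ?B k \<times> ?J (k - 1))"
    unfolding Omega_7_def
  proof (rule Phi_alpha_image_eq[OF _ _ branch_domain_7])
    fix k :: int
    assume "?B k \<noteq> {}"
    then have "real_of_int k \<ge> 1"
      using orbits(2) by (simp split: if_splits)
    then have pos: "0 < 2 * real_of_int k + 1 - gold_G"
      using gold_G_lt by linarith
    show "(\<lambda>y. 1 / (2 * real_of_int k + 1 + -1 * y)) ` {1..<gold_G} = ?J (k - 1)"
      using image_inverse_reflect[of "2 * real_of_int k + 1" gold_G 1, OF pos] gold_G_gt
      by (simp add: algebra_simps)
  qed auto
  also have "\<dots> = I_alpha \<alpha> \<times> (\<Union>k\<in>{k. K + 1 < k}. ?J (k - 1)) \<union> {\<gamma>..<\<alpha>} \<times> ?J (K + 1 - 1)"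
    by (rule UN_if_Times) simp
  also have "{k. K + 1 < k} = (\<lambda>k. k + 1) ` {K + 1..}"
    by (auto simp: image_iff intro!: bexI[of _ "_ - 1"])
  finally show ?thesis
    by (simp add: image_image add_ac)
qed

section \<open>Injectivity away from a null-set\<close>

lemma endpoint_order:
  "\<alpha> - 2 \<le> phi_alpha \<alpha> (\<alpha> - 2)" "phi_alpha \<alpha> (\<alpha> - 2) < 0" "phi_alpha \<alpha> \<alpha> < 1 / (1 + \<alpha>)"
  "1 / (1 + \<alpha>) < \<alpha>" "1 / (1 + \<alpha>) \<le> 2 - \<alpha>"
proof -
  have "\<alpha> * \<alpha> < 1"
    using mult_strict_mono[of \<alpha> 1 \<alpha> 1] bounds by simp
  then show "phi_alpha \<alpha> \<alpha> < 1 / (1 + \<alpha>)" "1 / (1 + \<alpha>) < \<alpha>" "1 / (1 + \<alpha>) \<le> 2 - \<alpha>"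
    "phi_alpha \<alpha> (\<alpha> - 2) < 0"
    using bounds
    by (simp_all add: phi_alpha_right[OF \<alpha>_gt \<alpha>_lt] phi_alpha_left[OF \<alpha>_gt \<alpha>_lt] field_simps)
  have "0 < 1 / (2 - \<alpha>)"
    using bounds by simp
  then show "\<alpha> - 2 \<le> phi_alpha \<alpha> (\<alpha> - 2)"
    unfolding phi_alpha_left[OF \<alpha>_gt \<alpha>_lt] using bounds by linarith
qed

definition pieces :: "(real \<times> real) set" where
  "pieces = Omega_1 \<alpha> \<union> Omega_2 \<alpha> \<union> Omega_3 \<alpha> \<union> Omega_4 \<alpha> \<union> Omega_5 \<alpha> \<union> Omega_6 \<alpha> \<union> Omega_7 \<alpha>"

text \<open>Heights 0 and 1 are removed because points of opposite sign collide there: equal digits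
  at height 0, adjacent digits at height 1. On height 2 - G the set \<open>Omega\<close> and the
  seven rectangles disagree.\<close>

definition regular_part :: "(real \<times> real) set" where
  "regular_part = {p \<in> Omega \<alpha>. fst p \<noteq> 0 \<and> snd p \<notin> {0, 2 - gold_G, 1}}"

lemma regular_part_eq: "regular_part = {p \<in> pieces. snd p \<notin> {0, 2 - gold_G, 1}}"
proof -
  \<comment> \<open>With the breakpoints on the x-axis ordered by \<open>endpoint_order\<close>,
    both memberships are Boolean combinations of linear comparisons.\<close>
  have "(x, y) \<in> regular_part \<longleftrightarrow> (x, y) \<in> {p \<in> pieces. snd p \<notin> {0, 2 - gold_G, 1}}" for x y
    using endpoint_order phi_alpha_right_pos gold_G_gt gold_G_lt
    unfolding regular_part_def pieces_def Omega_def Omega_I_def Omega_II_def Omega_III_def I_alpha_def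
      Omega_1_def Omega_2_def Omega_3_def Omega_4_def Omega_5_def Omega_6_def Omega_7_def
      mem_Collect_eq Un_iff mem_Times_iff fst_conv snd_conv insert_iff empty_iff
      atLeastLessThan_iff greaterThanAtMost_iff greaterThanLessThan_iff
    by argo
  then show ?thesis
    by auto
qed

lemma pieces_nonzero: "p \<in> pieces \<Longrightarrow> fst p \<noteq> 0"
  using endpoint_order phi_alpha_right_pos bounds
  by (cases p) (auto simp: pieces_def Omega_1_def Omega_2_def Omega_3_def Omega_4_def Omega_5_def
      Omega_6_def Omega_7_def)

lemma opposite_signs_no_collision:
  assumes S: "(x, y) \<in> regular_part" "(x', y') \<in> regular_part"
    and pos: "0 < 2 * real_of_int k + 1 + u" "0 < 2 * real_of_int k' + 1 + u"
    and x: "x = 1 / (2 * real_of_int k + 1 + u)" "x' = -1 / (2 * real_of_int k' + 1 + u)"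
    and eq: "2 * real_of_int k + 1 + y = 2 * real_of_int k' + 1 - y'"
  shows False
proof -
  have x_sgn: "0 < x" "x' < 0"
    using pos by (simp_all add: x)
  have y: "0 < y" "y < gold_G" "0 < y'" "y' < gold_G" "y \<noteq> 1" "y' \<noteq> 2 - gold_G" "y \<noteq> 2 - gold_G"
    using S gold_G_gt gold_G_lt
    by (auto simp: regular_part_def Omega_def Omega_I_def Omega_II_def Omega_III_def)
  \<comment> \<open>The number 2 (k' - k) equals y + y', which lies strictly between 0 and 2 G < 4;
    the only even integer there is 2.\<close>
  have "real_of_int 0 < real_of_int (2 * (k' - k))" "real_of_int (2 * (k' - k)) < real_of_int 4"
    using y gold_G_lt eq by auto
  then have k': "k' = k + 1"
    unfolding of_int_less_iff by presburger
  then have sum: "y + y' = 2"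
    using eq by simp
  \<comment> \<open>Strictly between the heights 2 - G and 1 only \<open>Omega_II\<close> is
    present, and it lies to the right of \<open>phi_alpha \<alpha> \<alpha>\<close>.\<close>
  have II: "phi_alpha \<alpha> \<alpha> < s" if "(s, t) \<in> regular_part" "2 - gold_G < t" "t < 1" for s t
    using that by (auto simp: regular_part_def Omega_def Omega_I_def Omega_II_def Omega_III_def)
  show False
  proof (cases "y < 1")
    case True
    \<comment> \<open>Here y > 2 - G because y' = 2 - y < G, while y' > 1 places the other point in
      \<open>Omega_III\<close>. The two resulting bounds on u contradict each other after the shift
      k' = k + 1.\<close>
    have "phi_alpha \<alpha> \<alpha> < x"
      using II[OF S(1)] True y sum by linarith
    then have "2 * real_of_int k + 1 + u < 2 * real_of_int K + 1 + \<gamma>"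
      using inverse_le_inverse_iff(2)[OF orbits(3) pos(1)] by (simp only: orbits(4)[symmetric] x)
    moreover have "phi_alpha \<alpha> (\<alpha> - 2) \<le> x'"
      using S(2) True sum gold_G_gt
      by (auto simp: regular_part_def Omega_def Omega_I_def Omega_II_def Omega_III_def)
    then have "1 / (2 * real_of_int k' + 1 + u) \<le> 1 / (2 * real_of_int K + 3 + \<gamma>)"
      unfolding orbits(5) x by simp
    then have "2 * real_of_int K + 3 + \<gamma> \<le> 2 * real_of_int k' + 1 + u"
      using orbits(3) by (subst (asm) inverse_le_inverse_iff(1)[OF pos(2)]) linarith+
    ultimately show False
      by (simp add: k')
  next
    case False
    \<comment> \<open>Now y > 1, so y' lies between 2 - G and 1, which is impossible at negative
      x'.\<close>
    then have "phi_alpha \<alpha> \<alpha> < x'"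
      using II[OF S(2)] y sum by linarith
    then show False
      using phi_alpha_right_pos x_sgn by linarith
  qed
qed

lemma inj_on_regular_part: "inj_on (Phi_alpha \<alpha>) regular_part"
proof (rule inj_onI)
  fix p q
  assume pq: "p \<in> regular_part" "q \<in> regular_part" "Phi_alpha \<alpha> p = Phi_alpha \<alpha> q"
  obtain x y x' y' where [simp]: "p = (x, y)" "q = (x', y')"
    by fastforce
  have nz: "x \<noteq> 0" "x' \<noteq> 0"
    using pq by (auto simp: regular_part_def)
  obtain k u where ku: "u \<in> I_alpha \<alpha>" "0 < 2 * real_of_int k + 1 + u"
      "x = sgn x / (2 * real_of_int k + 1 + u)"
    using obtain_inverse_branch[OF nz(1)] .
  obtain k' u' where ku': "u' \<in> I_alpha \<alpha>" "0 < 2 * real_of_int k' + 1 + u'"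
      "x' = sgn x' / (2 * real_of_int k' + 1 + u')"
    using obtain_inverse_branch[OF nz(2)] .
  have "\<bar>sgn x\<bar> = 1" "\<bar>sgn x'\<bar> = 1"
    using nz by simp_all
  then have "Phi_alpha \<alpha> p = (u, 1 / (2 * real_of_int k + 1 + sgn x * y))"
    "Phi_alpha \<alpha> q = (u', 1 / (2 * real_of_int k' + 1 + sgn x' * y'))"
    using Phi_alpha_inverse_branch[OF _ ku(1,2), of "sgn x" y]
      Phi_alpha_inverse_branch[OF _ ku'(1,2), of "sgn x'" y']
    by (simp_all flip: ku(3) ku'(3))
  then have u': "u' = u"
    and eq: "2 * real_of_int k + 1 + sgn x * y = 2 * real_of_int k' + 1 + sgn x' * y'"
    using pq(3) by simp_all
  have sgn_eq: "sgn x = sgn x'"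
  proof (rule ccontr)
    assume "sgn x \<noteq> sgn x'"
    then consider "sgn x = 1" "sgn x' = -1" | "sgn x = -1" "sgn x' = 1"
      using nz by (auto simp: sgn_if split: if_splits)
    then show False
    proof cases
      case 1
      have "x = 1 / (2 * real_of_int k + 1 + u)" "x' = -1 / (2 * real_of_int k' + 1 + u)"
        by (subst ku(3), simp only: 1) (subst ku'(3), simp only: 1 u')
      then show False
        using opposite_signs_no_collision[of x y x' y' k u k'] pq(1,2) ku(2) ku'(2) eq
        by (simp add: u' 1)
    next
      case 2
      have "x' = 1 / (2 * real_of_int k' + 1 + u)" "x = -1 / (2 * real_of_int k + 1 + u)"
        by (subst ku'(3), simp only: 2 u') (subst ku(3), simp only: 2)
      then show False
        using opposite_signs_no_collision[of x' y' x y k' u k] pq(1,2) ku(2) ku'(2) eq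
        by (simp add: u' 2)
    qed
  qed
  have y: "0 < y" "y < gold_G" "0 < y'" "y' < gold_G"
    using pq(1,2) gold_G_gt gold_G_lt
    by (auto simp: regular_part_def Omega_def Omega_I_def Omega_II_def Omega_III_def)
  have k_eq: "k = k'"
  proof -
    \<comment> \<open>With equal signs the heights differ by an even integer, yet by less than G <
      2.\<close>
    have "real_of_int \<bar>2 * (k - k')\<bar> = \<bar>sgn x * (y' - y)\<bar>"
      using eq sgn_eq by (simp add: algebra_simps)
    also have "\<dots> = \<bar>y' - y\<bar>"
      using nz by (simp add: abs_mult)
    also have "\<dots> < real_of_int 2"
      using y gold_G_lt by auto
    finally show ?thesis
      unfolding of_int_less_iff by presburger
  qed
  have "x = x'"
    by (subst ku(3), subst ku'(3)) (simp only: sgn_eq k_eq u')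
  moreover have "y = y'"
    using eq nz by (simp add: sgn_eq k_eq sgn_zero_iff)
  ultimately show "p = q"
    by simp
qed

section \<open>The images lie in \<open>Omega\<close> and cover it off countably many
  heights\<close>

lemma Phi_pieces_subset: "Phi_alpha \<alpha> ` pieces \<subseteq> Omega \<alpha>"
proof -
  have le: "1 / c \<le> 2 - gold_G" if "1 + gold_G \<le> c" for c
    using inverse_le_inverse_iff(1)[of c "1 + gold_G"] that gold_G_gt
    by (simp add: inverse_gold_G_plus_1)
  have less: "1 / c < 2 - gold_G" if "1 + gold_G < c" for c
    using inverse_le_inverse_iff(2)[of c "1 + gold_G"] that gold_G_gt
    by (simp add: inverse_gold_G_plus_1)
  have nonneg: "0 \<le> 1 / c" if "1 \<le> c" for c :: real
    using that by simp
  have co: "{a..<b} \<subseteq> {0..<c}" if "0 \<le> a" "b \<le> c" for a b c :: real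
    using that by auto
  have oc: "{a<..b} \<subseteq> {0..<c}" if "0 \<le> a" "b < c" for a b c :: real
    using that by auto
  have I: "{\<alpha> - 2..<\<gamma>} \<subseteq> I_alpha \<alpha>" "{\<gamma>..<\<alpha>} \<subseteq> I_alpha \<alpha>"
    using orbits(1) by (auto simp: I_alpha_def)
  have "{1 / (2 * real_of_int k + 1)..<1 / (2 * real_of_int k - 1 + gold_G)} \<subseteq> {0..<2 - gold_G}"
    "{1 / (2 * real_of_int k + 3 - gold_G)<..1 / (2 * real_of_int k + 1)} \<subseteq> {0..<2 - gold_G}"
    "{1 / (2 * real_of_int k + 1 + gold_G)<..1 / (2 * real_of_int k + 2)} \<subseteq> {0..<2 - gold_G}"
    "{1 / (2 * real_of_int k + 2)<..1 / (2 * real_of_int k + 3 - gold_G)} \<subseteq> {0..<2 - gold_G}"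
    "{1 / (2 * real_of_int k + 2)..<1 / (2 * real_of_int k + 3 - gold_G)} \<subseteq> {0..<2 - gold_G}"
    if "k \<ge> 1" for k
  proof -
    have "real_of_int k \<ge> 1"
      using that by simp
    \<comment> \<open>The smallest denominator is 2 k - 1 + G at k = 1, which gives exactly 1 / (1 +
      G) = 2 - G. It bounds an interval open on the right, so the weak inequality is enough there;
      intervals closed on the right need the strict one.\<close>
    then have "1 / (2 * real_of_int k - 1 + gold_G) \<le> 2 - gold_G"
      "1 / (2 * real_of_int k + 1) < 2 - gold_G" "1 / (2 * real_of_int k + 2) < 2 - gold_G"
      "1 / (2 * real_of_int k + 3 - gold_G) < 2 - gold_G"
      "1 / (2 * real_of_int k + 3 - gold_G) \<le> 2 - gold_G"
      "0 \<le> 1 / (2 * real_of_int k + 1)" "0 \<le> 1 / (2 * real_of_int k + 3 - gold_G)"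
      "0 \<le> 1 / (2 * real_of_int k + 1 + gold_G)" "0 \<le> 1 / (2 * real_of_int k + 2)"
      using gold_G_gt gold_G_lt by (intro le less nonneg; linarith)+
    then show
      "{1 / (2 * real_of_int k + 1)..<1 / (2 * real_of_int k - 1 + gold_G)} \<subseteq> {0..<2 - gold_G}"
      "{1 / (2 * real_of_int k + 3 - gold_G)<..1 / (2 * real_of_int k + 1)} \<subseteq> {0..<2 - gold_G}"
      "{1 / (2 * real_of_int k + 1 + gold_G)<..1 / (2 * real_of_int k + 2)} \<subseteq> {0..<2 - gold_G}"
      "{1 / (2 * real_of_int k + 2)<..1 / (2 * real_of_int k + 3 - gold_G)} \<subseteq> {0..<2 - gold_G}"
      "{1 / (2 * real_of_int k + 2)..<1 / (2 * real_of_int k + 3 - gold_G)} \<subseteq> {0..<2 - gold_G}"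
      by (simp_all only: co oc)
  qed
  note J = this
  have "Phi_alpha \<alpha> ` Omega_3 \<alpha> \<subseteq> Omega_I \<alpha>"
    unfolding Phi_image_3 Omega_I_def by (intro Sigma_mono order_refl UN_least J) simp
  moreover have "Phi_alpha \<alpha> ` Omega_4 \<alpha> \<subseteq> Omega_I \<alpha>"
    unfolding Phi_image_4 Omega_I_def by (intro Sigma_mono order_refl UN_least J) simp
  moreover have "Phi_alpha \<alpha> ` Omega_5 \<alpha> \<subseteq> Omega_I \<alpha>"
    unfolding Phi_image_5 Omega_I_def by (intro Sigma_mono order_refl UN_least J) simp
  moreover have "Phi_alpha \<alpha> ` Omega_6 \<alpha> \<subseteq> Omega_I \<alpha>"
    unfolding Phi_image_6 Omega_I_def using orbits(2)
    by (intro Un_least Sigma_mono order_refl UN_least I J) auto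
  moreover have "Phi_alpha \<alpha> ` Omega_7 \<alpha> \<subseteq> Omega_I \<alpha>"
    unfolding Phi_image_7 Omega_I_def using orbits(2)
    by (intro Un_least Sigma_mono order_refl UN_least I J) auto
  ultimately show ?thesis
    by (simp add: pieces_def image_Un Phi_image_1 Phi_image_2 Omega_def le_supI1)
qed

text \<open>The indices \<open>m = n = 0\<close> contribute the height 0, since \<open>1 / 0 = 0\<close>.\<close>

definition exceptional_heights :: "real set" where
  "exceptional_heights = range (\<lambda>(m :: int, n :: int). 1 / (of_int m + of_int n * gold_G))"

lemma exceptional_heightsI: "v = 1 / (of_int m + of_int n * gold_G) \<Longrightarrow> v \<in> exceptional_heights"
  unfolding exceptional_heights_def by (rule range_eqI[of _ _ "(m, n)"]) simp

text \<open>The three removed heights are integer combinations of 1 and G, and so is d + e y for an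
  integer digit d and an integer sign e. This controls the images of the points of
  \<open>pieces\<close> outside \<open>regular_part\<close>.\<close>

lemma Phi_exceptional_height:
  assumes "snd p \<in> {0, 2 - gold_G, 1}"
  shows "snd (Phi_alpha \<alpha> p) \<in> exceptional_heights"
proof -
  obtain x y where p: "p = (x, y)"
    by fastforce
  obtain a b :: int where y: "y = of_int a + of_int b * gold_G"
  proof -
    consider "y = 0" | "y = 2 - gold_G" | "y = 1"
      using assms p by auto
    then show ?thesis
    proof cases
      case 1 then show ?thesis using that[of 0 0] by simp
    next
      case 2 then show ?thesis using that[of 2 "-1"] by simp
    next
      case 3 then show ?thesis using that[of 1 0] by simp
    qed
  qed
  \<comment> \<open>The case x = 0 is harmless, as \<open>sgn 0 = 0\<close> is an integer
    too.\<close>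
  obtain s :: int where s: "sgn x = of_int s"
    by (rule that[of "if x = 0 then 0 else if 0 < x then 1 else -1"]) (simp add: sgn_if)
  show ?thesis
    by (rule exceptional_heightsI[of _ "d_alpha \<alpha> x + s * a" "s * b"])
      (simp add: p y Phi_alpha_def s algebra_simps)
qed

text \<open>In \<open>Omega_I\<close>, locate 1 / v in [2 k + 1, 2 k + 3) and cut this interval at 2
  k + 3 - G < 2 k + 2 < 2 k + 1 + G. From left to right the four parts are covered by the images of
  \<open>Omega_4\<close>, of \<open>Omega_6\<close> or \<open>Omega_7\<close>, of
  \<open>Omega_5\<close>, and of \<open>Omega_3\<close>. Excluding the exceptional heights avoids
  disputes at the cuts.\<close>

lemma Omega_subset_Phi_pieces:
  assumes "p \<in> Omega \<alpha>" "snd p \<notin> exceptional_heights"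
  shows "p \<in> Phi_alpha \<alpha> ` pieces"
proof (cases "p \<in> Omega_I \<alpha>")
  case False
  then show ?thesis
    using assms(1) Phi_image_1 Phi_image_2 by (auto simp: Omega_def pieces_def)
next
  case True
  obtain u v where p: "p = (u, v)"
    by fastforce
  have u: "u \<in> I_alpha \<alpha>" and v: "0 \<le> v" "v < 2 - gold_G"
    using True by (auto simp: p Omega_I_def)
  have exc: "1 / v \<noteq> of_int m + of_int n * gold_G" for m n
  proof
    assume "1 / v = of_int m + of_int n * gold_G"
    then have "v = 1 / (of_int m + of_int n * gold_G)"
      by (metis div_by_1 divide_divide_eq_right mult_1)
    then show False
      using assms(2) exceptional_heightsI by (auto simp: p)
  qed
  \<comment> \<open>The instance m = n = 0 rules out v = 0, because 1 / 0 = 0.\<close>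
  have v_pos: "0 < v"
    using v exc[of 0 0] by (cases "v = 0") auto
  have iff: "1 / c \<le> v \<longleftrightarrow> 1 / v \<le> c" "1 / c < v \<longleftrightarrow> 1 / v < c"
    "v \<le> 1 / c \<longleftrightarrow> c \<le> 1 / v" "v < 1 / c \<longleftrightarrow> c < 1 / v" if "0 < c" for c
    using that v_pos by (auto simp: field_simps)
  have w: "1 + gold_G < 1 / v"
    using v iff(4)[of "1 + gold_G"] gold_G_gt by (simp add: inverse_gold_G_plus_1)
  define k where "k = \<lfloor>(1 / v - 1) / 2\<rfloor>"
  have "2 * real_of_int \<lfloor>(w - 1) / 2\<rfloor> + 1 \<le> w \<and> w < 2 * real_of_int \<lfloor>(w - 1) / 2\<rfloor> + 3" for w :: real
    using floor_correct[of "(w - 1) / 2"] by (simp add: field_simps)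
  from this[of "1 / v"] have k: "2 * real_of_int k + 1 \<le> 1 / v" "1 / v < 2 * real_of_int k + 3"
    by (simp_all only: k_def)
  have ne: "1 / v \<noteq> 2 * real_of_int k + 3 - gold_G" "1 / v \<noteq> 2 * real_of_int k + 1 + gold_G"
    using exc[of "2 * k + 3" "-1"] exc[of "2 * k + 1" 1] by simp_all
  have "k \<ge> 0"
    using k(2) w gold_G_gt by linarith
  \<comment> \<open>The index in the image of \<open>Omega_3\<close> is k + 1, as its heights lie
    just above 1 / (2 k + 3).\<close>
  have three: ?thesis if "2 * real_of_int k + 1 + gold_G < 1 / v"
  proof -
    have "v \<in> {1 / (2 * real_of_int (k + 1) + 1)..<1 / (2 * real_of_int (k + 1) - 1 + gold_G)}"
      using that k \<open>k \<ge> 0\<close> gold_G_gt by (simp add: iff algebra_simps)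
    then have "p \<in> Phi_alpha \<alpha> ` Omega_3 \<alpha>"
      unfolding Phi_image_3 using u \<open>k \<ge> 0\<close> by (auto simp: p intro!: bexI[of _ "k + 1"])
    then show ?thesis
      by (auto simp: pieces_def)
  qed
  show ?thesis
  proof (cases "k = 0")
    case True
    \<comment> \<open>For k = 0 only the last part remains, since v < 2 - G means 1 / v > 1 +
      G.\<close>
    then show ?thesis
      using three w by simp
  next
    case False
    then have k1: "k \<ge> 1" and rk1: "real_of_int k \<ge> 1"
      using \<open>k \<ge> 0\<close> by simp_all
    consider "1 / v < 2 * real_of_int k + 3 - gold_G"
      | "2 * real_of_int k + 3 - gold_G < 1 / v" "1 / v < 2 * real_of_int k + 2"
      | "2 * real_of_int k + 2 \<le> 1 / v" "1 / v < 2 * real_of_int k + 1 + gold_G"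
      | "2 * real_of_int k + 1 + gold_G < 1 / v"
      using ne by linarith
    then show ?thesis
    proof cases
      case 1
      then have "v \<in> {1 / (2 * real_of_int k + 3 - gold_G)<..1 / (2 * real_of_int k + 1)}"
        using k rk1 gold_G_lt by (simp add: iff)
      then have "p \<in> Phi_alpha \<alpha> ` Omega_4 \<alpha>"
        unfolding Phi_image_4 using u k1 by (auto simp: p)
      then show ?thesis
        by (auto simp: pieces_def)
    next
      case 2
      then have v': "1 / (2 * real_of_int k + 2) < v" "v < 1 / (2 * real_of_int k + 3 - gold_G)"
        using rk1 gold_G_lt by (simp_all add: iff)
      show ?thesis
      \<comment> \<open>The truncated branches meet here: \<open>Omega_6\<close> covers the pairs
        (k, u) lexicographically below (K, \<gamma>), and \<open>Omega_7\<close> covers the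
        rest.\<close>
      proof (cases "k < K \<or> k = K \<and> u < \<gamma>")
        case True
        then have "p \<in> Phi_alpha \<alpha> ` Omega_6 \<alpha>"
          unfolding Phi_image_6 using u v' k1 by (auto simp: p I_alpha_def)
        then show ?thesis
          by (auto simp: pieces_def)
      next
        case False
        then have "p \<in> Phi_alpha \<alpha> ` Omega_7 \<alpha>"
          unfolding Phi_image_7 using u v' by (cases "k = K") (auto simp: p I_alpha_def)
        then show ?thesis
          by (auto simp: pieces_def)
      qed
    next
      case 3
      then have "v \<in> {1 / (2 * real_of_int k + 1 + gold_G)<..1 / (2 * real_of_int k + 2)}"
        using rk1 gold_G_gt by (simp add: iff)
      then have "p \<in> Phi_alpha \<alpha> ` Omega_5 \<alpha>"
        unfolding Phi_image_5 using u k1 by (auto simp: p)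
      then show ?thesis
        by (auto simp: pieces_def)
    qed (rule three)
  qed
qed

section \<open>Null-sets and the bijection\<close>

lemma Phi_bij_upto_null: "Phi_bij_upto_null \<alpha>"
  unfolding Phi_bij_upto_null_def
proof (intro exI conjI)
  let ?S = "regular_part"
  \<comment> \<open>With these choices the bijection goes from \<open>regular_part\<close> onto its
    own image, so that only the nullity of both differences and the inclusion of the image in
    \<open>Omega\<close> remain.\<close>
  let ?N1 = "Omega \<alpha> - ?S" and ?N2 = "Omega \<alpha> - Phi_alpha \<alpha> ` ?S"
  have null_line: "{p :: real \<times> real. snd p = c} \<in> null_sets lebesgue"
    "{p :: real \<times> real. fst p = c} \<in> null_sets lebesgue" for c
    using negligible_standard_hyperplane[of "(0, 1) :: real \<times> real" c]
      negligible_standard_hyperplane[of "(1, 0) :: real \<times> real" c]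
    by (simp_all add: negligible_iff_null_sets Basis_prod_def inner_prod_def)
  have null_heights: "{p :: real \<times> real. snd p \<in> C} \<in> null_sets lebesgue" if "countable C" for C
  proof -
    have "{p :: real \<times> real. snd p \<in> C} = (\<Union>c\<in>C. {p. snd p = c})"
      by auto
    also have "\<dots> \<in> null_sets lebesgue"
      by (intro null_sets_UN' that null_line)
    finally show ?thesis .
  qed
  have null_subset: "A \<in> null_sets lebesgue" if "A \<subseteq> B" "B \<in> null_sets lebesgue"
    for A B :: "(real \<times> real) set"
    using that negligible_subset negligible_iff_null_sets by blast
  have "?N1 \<subseteq> {p. snd p \<in> {0, 2 - gold_G, 1}} \<union> {p. fst p = 0}"
    by (auto simp: regular_part_def)
  then show "?N1 \<in> null_sets lebesgue"
    by (rule null_subset) (intro null_sets.Un null_heights null_line; simp)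
  have sub: "?S \<subseteq> pieces"
    by (auto simp: regular_part_eq)
  have "?N2 \<subseteq> {p. snd p \<in> exceptional_heights}"
  proof
    fix p assume p: "p \<in> ?N2"
    show "p \<in> {p. snd p \<in> exceptional_heights}"
    proof (rule ccontr)
      assume neg: "p \<notin> {p. snd p \<in> exceptional_heights}"
      \<comment> \<open>Such a point has a preimage in \<open>pieces\<close> but none in
        \<open>regular_part\<close>, so the preimage sits at one of the three removed heights, and
        its image is then at an exceptional height.\<close>
      then obtain q where q: "q \<in> pieces" "p = Phi_alpha \<alpha> q"
        using Omega_subset_Phi_pieces p by blast
      then have "q \<notin> ?S"
        using p by blast
      then show False
        using neg q Phi_exceptional_height[of q] by (auto simp: regular_part_eq)
    qed
  qed
  then show "?N2 \<in> null_sets lebesgue"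
    by (rule null_subset) (simp add: null_heights exceptional_heights_def)
  show "{p \<in> Omega \<alpha>. fst p = 0} \<subseteq> ?N1"
    by (auto simp: regular_part_def)
  have "Omega \<alpha> - ?N1 = ?S"
    by (auto simp: regular_part_def)
  moreover have "Omega \<alpha> - ?N2 = Phi_alpha \<alpha> ` ?S"
    using Phi_pieces_subset sub by blast
  ultimately show "bij_betw (Phi_alpha \<alpha>) (Omega \<alpha> - ?N1) (Omega \<alpha> - ?N2)"
    using inj_on_regular_part by (simp add: inj_on_imp_bij_betw)
qed

end

end

theorem lemma2:
  fixes \<alpha> :: real and K :: int
  assumes "gold_g < \<alpha>" and "\<alpha> < 1"
    and "2 * K + 1 = d_alpha \<alpha> (phi_alpha \<alpha> \<alpha>)"
  shows "Phi_bij_upto_null \<alpha> \<and>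
    Phi_alpha \<alpha> ` Omega_1 \<alpha> = Omega_III \<alpha> \<and>
    Phi_alpha \<alpha> ` Omega_2 \<alpha> = Omega_II \<alpha> \<and>
    Phi_alpha \<alpha> ` Omega_3 \<alpha> = I_alpha \<alpha> \<times>
      (\<Union>k\<in>{1::int..}. {1 / (2 * real_of_int k + 1)..<1 / (2 * real_of_int k - 1 + gold_G)}) \<and>
    Phi_alpha \<alpha> ` Omega_4 \<alpha> = I_alpha \<alpha> \<times>
      (\<Union>k\<in>{1::int..}. {1 / (2 * real_of_int k + 3 - gold_G)<..1 / (2 * real_of_int k + 1)}) \<and>
    Phi_alpha \<alpha> ` Omega_5 \<alpha> = I_alpha \<alpha> \<times>
      (\<Union>k\<in>{1::int..}. {1 / (2 * real_of_int k + 1 + gold_G)<..1 / (2 * real_of_int k + 2)}) \<and>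
    Phi_alpha \<alpha> ` Omega_6 \<alpha> =
      (I_alpha \<alpha> \<times>
        (\<Union>k\<in>{1..K - 1}. {1 / (2 * real_of_int k + 2)<..1 / (2 * real_of_int k + 3 - gold_G)})) \<union>
      ({\<alpha> - 2..<phi_alpha \<alpha> (phi_alpha \<alpha> \<alpha>)} \<times>
        {1 / (2 * real_of_int K + 2)<..1 / (2 * real_of_int K + 3 - gold_G)}) \<and>
    Phi_alpha \<alpha> ` Omega_7 \<alpha> =
      (I_alpha \<alpha> \<times>
        (\<Union>k\<in>{K + 1..}. {1 / (2 * real_of_int k + 2)..<1 / (2 * real_of_int k + 3 - gold_G)})) \<union>
      ({phi_alpha \<alpha> (phi_alpha \<alpha> \<alpha>)..<\<alpha>} \<times>
        {1 / (2 * real_of_int K + 2)..<1 / (2 * real_of_int K + 3 - gold_G)})"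
  using Phi_bij_upto_null[OF assms] Phi_image_1[OF assms(1,2)] Phi_image_2[OF assms(1,2)]
    Phi_image_3[OF assms(1,2)] Phi_image_4[OF assms(1,2)] Phi_image_5[OF assms(1,2)]
    Phi_image_6[OF assms] Phi_image_7[OF assms]
  by (intro conjI)

end
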